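(* Let $b>0$ and let $\rho$ belong to the admissible class $\mathcal A$. Let $D(k)$ and the Jost solution $f(x;k)$ be as defined in the context. Then $$D(k)=\frac{f(0;k)-f(0;-k)}{2ik},\qquad k\in\mathbb C,$$ where at $k=0$ the right-hand side is understood as its limit as $k\to0$. For real $k$-values, $$\operatorname{Im}[f(0;k)]=k\,D(k),\qquad k\in\mathbb R.$$
   Context: Fix $b>0$. The admissible class $\mathcal A$ consists of the real-valued functions $\rho$ on $[0,+\infty)$ such that $\rho(x)$ is positive and continuously differentiable, $\rho(x)=1$ for $x\ge b$, and $\rho''(x)$ exists almost everywhere. Primes denote $x$-derivatives. For $k\in\mathbb C$ let $\phi(x;k)$ be the unique solution of $\phi''+k^2\rho(x)\phi=0$ for $x>0$ with $\phi(0;k)=0$, $\phi'(0;k)=1$, and set $$D(k):=\frac{\sin(kb)}{k}\,\phi'(b;k)-\cos(kb)\,\phi(b;k)$$ (with $\sin(kb)/k:=b$ at $k=0$). For $k\in\mathbb C$ the Jost solution $f(x;k)$ is the solution of $\psi''+k^2\rho(x)\psi=0$, $x>0$, satisfying $f(x;k)=e^{ikx}$ and $f'(x;k)=ik\,e^{ikx}$ for $x\ge b$. *)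

theory Defs
  imports "HOL-Analysis.Analysis"
begin

text \<open>
  Functions on the half-line \<open>[0, \<infinity>)\<close> are represented by total functions on the reals whose
  values at negative arguments are irrelevant. Accordingly every derivative is taken within
  \<open>[0, \<infinity>)\<close>: two-sided at \<open>x > 0\<close>, one-sided at \<open>x = 0\<close>.
\<close>

definition admissible :: "real \<Rightarrow> (real \<Rightarrow> real) set" where
  "admissible b = {\<rho>.
     (\<forall>x\<ge>0. \<rho> x > 0) \<and>
     (\<forall>x\<ge>b. \<rho> x = 1) \<and>
     (\<exists>\<rho>'. (\<forall>x\<ge>0. (\<rho> has_real_derivative \<rho>' x) (at x within {0..})) \<and>
           continuous_on {0..} \<rho>' \<and>
           (AE x in lebesgue. x \<ge> 0 \<longrightarrow>
              (\<exists>l. (\<rho>' has_real_derivative l) (at x within {0..}))))}"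

definition deriv_hl :: "(real \<Rightarrow> complex) \<Rightarrow> real \<Rightarrow> complex" where
  "deriv_hl u x = vector_derivative u (at x within {0..})"

text \<open>
  Classical solutions of \<open>u'' + k\<^sup>2 \<rho> u = 0\<close> for \<open>x > 0\<close> that are continuously differentiable up
  to the endpoint \<open>x = 0\<close>, so that \<open>u(0)\<close> and \<open>u'(0)\<close> are meaningful.
\<close>

definition is_solution :: "(real \<Rightarrow> real) \<Rightarrow> complex \<Rightarrow> (real \<Rightarrow> complex) \<Rightarrow> bool" where
  "is_solution \<rho> k u \<longleftrightarrow>
     (\<forall>x\<ge>0. u differentiable (at x within {0..})) \<and>
     continuous_on {0..} (deriv_hl u) \<and>
     (\<forall>x>0. \<exists>w. (deriv_hl u has_vector_derivative w) (at x) \<and>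
                w + k\<^sup>2 * of_real (\<rho> x) * u x = 0)"

text \<open>
  Solutions are unique on \<open>[0, \<infinity>)\<close> only; the value \<open>0\<close> prescribed at negative arguments makes
  the total functions below unique, as required by the definite descriptions.
\<close>

definition \<phi> :: "(real \<Rightarrow> real) \<Rightarrow> complex \<Rightarrow> real \<Rightarrow> complex" where
  "\<phi> \<rho> k = (THE u. is_solution \<rho> k u \<and> u 0 = 0 \<and> deriv_hl u 0 = 1 \<and> (\<forall>x<0. u x = 0))"

definition jost :: "real \<Rightarrow> (real \<Rightarrow> real) \<Rightarrow> complex \<Rightarrow> real \<Rightarrow> complex" where
  "jost b \<rho> k = (THE u. is_solution \<rho> k u \<and>
     (\<forall>x\<ge>b. u x = exp (\<i> * k * of_real x) \<and>
            deriv_hl u x = \<i> * k * exp (\<i> * k * of_real x)) \<and>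
     (\<forall>x<0. u x = 0))"

definition D :: "real \<Rightarrow> (real \<Rightarrow> real) \<Rightarrow> complex \<Rightarrow> complex" where
  "D b \<rho> k =
     (if k = 0 then of_real b else sin (k * of_real b) / k) * deriv_hl (\<phi> \<rho> k) b
     - cos (k * of_real b) * \<phi> \<rho> k b"

end

theory Submission
  imports Defs
begin

text \<open>
  The identity is a Wronskian computation. Write \<open>f\<close> for the Jost solution. Because of the initial
  values \<open>\<phi>(0) = 0\<close> and \<open>\<phi>'(0) = 1\<close>, the constant Wronskian \<open>f \<phi>' - f' \<phi>\<close> equals \<open>f(0; k)\<close>
  at the origin, while at \<open>b\<close> the function \<open>f\<close> is the explicit exponential. This gives
  \<open>f(0; k) = exp (\<i> k b) (\<phi>'(b; k) - \<i> k \<phi>(b; k))\<close> (lemma \<open>jost_at_0\<close>). Since \<open>\<phi>\<close> depends only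
  on \<open>k\<^sup>2\<close>, subtracting the same formula for \<open>- k\<close> leaves \<open>2 \<i> k D(k)\<close>. For real \<open>k\<close> the
  function \<open>\<phi>\<close> is real and the imaginary part can be read off directly.

  Since \<open>\<phi>\<close> and the Jost solution are definite descriptions, existence and uniqueness of
  solutions have to be established. Existence comes from the expansion
  \<open>u = (\<Sum>n. (- k\<^sup>2) ^ n * u\<^sub>n)\<close>, in which each coefficient \<open>u\<^sub>n\<close> is real and is obtained from the
  preceding one by multiplying with \<open>\<rho>\<close> and integrating twice; on every bounded interval the
  series is dominated by an exponential series (lemma \<open>iter_coeff_series_dominated\<close>). Compared
  with a fixed-point argument this has the advantage of delivering at once two further
  ingredients: continuity of \<open>\<phi>(b; k)\<close> and \<open>\<phi>'(b; k)\<close> in \<open>k\<close>, which identifies the limit at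
  \<open>k = 0\<close>, and reality of \<open>\<phi>\<close> for real \<open>k\<close>. The series yields two solutions with Wronskian \<open>1\<close>;
  every solution is their combination with constant Wronskians as coefficients, which gives
  uniqueness (lemma \<open>solution_unique\<close>) and, by matching Cauchy data at \<open>b\<close>, the Jost solution.
\<close>

section \<open>Solving the equation by a power series in the spectral parameter\<close>

lemma at_within_atLeast_eq_Icc:
  fixes x a R :: real
  assumes "x < R"
  shows "at x within {a..} = at x within {a..R}"
  using assms by (intro at_within_nhd[of _ "{..<R}"]) auto

lemma integral_has_real_derivative_atLeast:
  fixes g :: "real \<Rightarrow> real"
  assumes g: "continuous_on {a..} g" and x: "x \<ge> a"
  shows "((\<lambda>x. integral {a..x} g) has_real_derivative g x) (at x within {a..})"
proof -
  have "continuous_on {a..x+1} g"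
    by (rule continuous_on_subset[OF g]) auto
  then have "((\<lambda>x. integral {a..x} g) has_real_derivative g x) (at x within {a..x+1})"
    by (rule integral_has_real_derivative) (use x in auto)
  then show ?thesis
    by (subst at_within_atLeast_eq_Icc[of x "x+1"]) auto
qed

lemma abs_integral_le_monomial:
  fixes g :: "real \<Rightarrow> real"
  assumes x: "x \<ge> 0" and g: "continuous_on {0..x} g"
    and le: "\<And>t. t \<in> {0..x} \<Longrightarrow> \<bar>g t\<bar> \<le> c * t ^ n"
  shows "\<bar>integral {0..x} g\<bar> \<le> c * x ^ Suc n / (Suc n)"
proof -
  have "((\<lambda>t. c * t ^ n) has_integral (c * x ^ Suc n / (Suc n) - c * 0 ^ Suc n / (Suc n))) {0..x}"
    by (rule fundamental_theorem_of_calculus[OF x])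
      (auto simp: has_real_derivative_iff_has_vector_derivative[symmetric]
        intro!: derivative_eq_intros simp del: power_Suc)
  then have I: "((\<lambda>t. c * t ^ n) has_integral c * x ^ Suc n / (Suc n)) {0..x}"
    by simp
  have "norm (integral {0..x} g) \<le> integral {0..x} (\<lambda>t. c * t ^ n)"
    using le g
    by (intro integral_norm_bound_integral integrable_continuous_interval continuous_intros) auto
  also have "\<dots> = c * x ^ Suc n / (Suc n)"
    using I by (simp add: has_integral_iff)
  finally show ?thesis by simp
qed

text \<open>
  The coefficients of the series \<open>u = (\<Sum>n. z ^ n * iter_coeff q p d n)\<close> that solves
  \<open>u'' = z * q * u\<close> with \<open>u(0) = p\<close> and \<open>u'(0) = d\<close>: comparing powers of \<open>z\<close> forces the
  second derivative of each coefficient to be \<open>q\<close> times the preceding one.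
\<close>

primrec iter_coeff :: "(real \<Rightarrow> real) \<Rightarrow> real \<Rightarrow> real \<Rightarrow> nat \<Rightarrow> real \<Rightarrow> real" where
  "iter_coeff q p d 0 = (\<lambda>x. p + d * x)"
| "iter_coeff q p d (Suc n) =
     (\<lambda>x. integral {0..x} (\<lambda>s. integral {0..s} (\<lambda>t. q t * iter_coeff q p d n t)))"

primrec iter_coeff_deriv :: "(real \<Rightarrow> real) \<Rightarrow> real \<Rightarrow> real \<Rightarrow> nat \<Rightarrow> real \<Rightarrow> real" where
  "iter_coeff_deriv q p d 0 = (\<lambda>x. d)"
| "iter_coeff_deriv q p d (Suc n) = (\<lambda>x. integral {0..x} (\<lambda>t. q t * iter_coeff q p d n t))"

lemma iter_coeff_Suc_eq_integral:
  "iter_coeff q p d (Suc n) x = integral {0..x} (iter_coeff_deriv q p d (Suc n))"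
  by simp

lemma iter_coeff_deriv_Suc_has_derivative_if_continuous:
  assumes "continuous_on {0..} q" "continuous_on {0..} (iter_coeff q p d n)" "x \<ge> 0"
  shows "(iter_coeff_deriv q p d (Suc n) has_real_derivative q x * iter_coeff q p d n x)
           (at x within {0..})"
  unfolding iter_coeff_deriv.simps
  using assms by (intro integral_has_real_derivative_atLeast continuous_intros)

lemma iter_coeff_Suc_has_derivative_if_continuous:
  assumes "continuous_on {0..} q" "continuous_on {0..} (iter_coeff q p d n)" "x \<ge> 0"
  shows "(iter_coeff q p d (Suc n) has_real_derivative iter_coeff_deriv q p d (Suc n) x)
           (at x within {0..})"
proof -
  have "continuous_on {0..} (iter_coeff_deriv q p d (Suc n))"
    by (rule DERIV_continuous_on)
      (use iter_coeff_deriv_Suc_has_derivative_if_continuous[OF assms(1,2)] in auto)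
  from integral_has_real_derivative_atLeast[OF this assms(3)] show ?thesis
    by simp
qed

lemma continuous_on_iter_coeff:
  assumes "continuous_on {0..} q"
  shows "continuous_on {0..} (iter_coeff q p d n)"
proof (induction n)
  case 0
  show ?case by (auto intro!: continuous_intros)
next
  case (Suc n)
  show ?case
    by (rule DERIV_continuous_on)
      (use iter_coeff_Suc_has_derivative_if_continuous[OF assms Suc] in auto)
qed

lemma iter_coeff_has_derivative:
  assumes "continuous_on {0..} q" "x \<ge> 0"
  shows "(iter_coeff q p d n has_real_derivative iter_coeff_deriv q p d n x) (at x within {0..})"
proof (cases n)
  case 0
  then show ?thesis by (auto intro!: derivative_eq_intros)
next
  case (Suc m)
  then show ?thesis
    using iter_coeff_Suc_has_derivative_if_continuous[OF assms(1) continuous_on_iter_coeff]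
      assms by blast
qed

lemma iter_coeff_deriv_Suc_has_derivative:
  assumes "continuous_on {0..} q" "x \<ge> 0"
  shows "(iter_coeff_deriv q p d (Suc n) has_real_derivative q x * iter_coeff q p d n x)
           (at x within {0..})"
  using iter_coeff_deriv_Suc_has_derivative_if_continuous continuous_on_iter_coeff assms by blast

lemma continuous_on_iter_coeff_deriv:
  assumes "continuous_on {0..} q"
  shows "continuous_on {0..} (iter_coeff_deriv q p d n)"
proof (cases n)
  case (Suc m)
  show ?thesis unfolding Suc
    by (rule DERIV_continuous_on)
      (use iter_coeff_deriv_Suc_has_derivative[OF assms] in auto)
qed auto

text \<open>
  Each step integrates twice. One integration alone produces the factorial, so the other is
  estimated crudely by the length \<open>R\<close> of the interval.
\<close>

lemma iter_coeff_bounds: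
  fixes q :: "real \<Rightarrow> real" and p d R M :: real
  assumes q: "continuous_on {0..} q" and M: "\<And>t. t \<in> {0..R} \<Longrightarrow> \<bar>q t\<bar> \<le> M" and x: "x \<in> {0..R}"
  defines "C \<equiv> \<bar>p\<bar> + \<bar>d\<bar> * R"
  shows abs_iter_coeff_le: "\<bar>iter_coeff q p d n x\<bar> \<le> C * (M * R) ^ n / fact n * x ^ n"
    and abs_iter_coeff_deriv_le:
      "\<bar>iter_coeff_deriv q p d (Suc n) x\<bar> \<le> M * C * (M * R) ^ n / fact (Suc n) * x ^ Suc n"
proof -
  have R: "R \<ge> 0" and M0: "M \<ge> 0"
    using x M[of x] by auto
  then have C: "C \<ge> 0"
    by (simp add: C_def)
  have deriv: "\<bar>iter_coeff_deriv q p d (Suc n) y\<bar>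
      \<le> M * C * (M * R) ^ n / fact (Suc n) * y ^ Suc n"
    if IH: "\<And>x. x \<in> {0..R} \<Longrightarrow> \<bar>iter_coeff q p d n x\<bar> \<le> C * (M * R) ^ n / fact n * x ^ n"
      and y: "y \<in> {0..R}" for n y
  proof -
    have "\<bar>integral {0..y} (\<lambda>t. q t * iter_coeff q p d n t)\<bar>
        \<le> (M * (C * (M * R) ^ n / fact n)) * y ^ Suc n / (Suc n)"
    proof (rule abs_integral_le_monomial)
      show "continuous_on {0..y} (\<lambda>t. q t * iter_coeff q p d n t)"
        by (rule continuous_on_subset[of "{0..}"])
          (auto intro!: continuous_intros q continuous_on_iter_coeff)
    next
      fix t assume t: "t \<in> {0..y}"
      then have "\<bar>q t * iter_coeff q p d n t\<bar> \<le> M * (C * (M * R) ^ n / fact n * t ^ n)"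
        unfolding abs_mult using M0 y by (intro mult_mono M IH) auto
      then show "\<bar>q t * iter_coeff q p d n t\<bar> \<le> M * (C * (M * R) ^ n / fact n) * t ^ n"
        by (simp add: mult.assoc)
    qed (use y in auto)
    then show ?thesis
      by (simp add: field_simps)
  qed
  have main: "\<bar>iter_coeff q p d n y\<bar> \<le> C * (M * R) ^ n / fact n * y ^ n" if "y \<in> {0..R}" for n y
    using that
  proof (induction n arbitrary: y)
    case 0
    have "\<bar>p + d * y\<bar> \<le> \<bar>p\<bar> + \<bar>d\<bar> * \<bar>y\<bar>"
      by (metis abs_mult abs_triangle_ineq)
    also have "\<dots> \<le> C"
      unfolding C_def using 0 by (intro add_mono mult_left_mono) auto
    finally show ?case by simp
  next
    case (Suc n)
    define K where "K = M * C * (M * R) ^ n / fact (Suc n) * y ^ Suc n"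
    have K: "K \<ge> 0"
      unfolding K_def using M0 C R Suc.prems by auto
    have "\<bar>iter_coeff q p d (Suc n) y\<bar> \<le> K * y ^ Suc 0 / (Suc 0)"
      unfolding iter_coeff_Suc_eq_integral
    proof (rule abs_integral_le_monomial)
      show "continuous_on {0..y} (iter_coeff_deriv q p d (Suc n))"
        by (rule continuous_on_subset[OF continuous_on_iter_coeff_deriv[OF q]]) auto
    next
      fix t assume t: "t \<in> {0..y}"
      have "\<bar>iter_coeff_deriv q p d (Suc n) t\<bar>
          \<le> M * C * (M * R) ^ n / fact (Suc n) * t ^ Suc n"
        by (rule deriv[OF Suc.IH]) (use t Suc.prems in auto)
      also have "\<dots> \<le> K"
        unfolding K_def using t M0 C R by (intro mult_left_mono power_mono) auto
      finally show "\<bar>iter_coeff_deriv q p d (Suc n) t\<bar> \<le> K * t ^ 0"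
        by simp
    qed (use Suc.prems in auto)
    also have "\<dots> \<le> K * R"
      using K Suc.prems by (auto intro: mult_left_mono)
    also have "\<dots> = C * (M * R) ^ Suc n / fact (Suc n) * y ^ Suc n"
      by (simp add: K_def field_simps)
    finally show ?case .
  qed
  show "\<bar>iter_coeff q p d n x\<bar> \<le> C * (M * R) ^ n / fact n * x ^ n"
    by (rule main[OF x])
  show "\<bar>iter_coeff_deriv q p d (Suc n) x\<bar> \<le> M * C * (M * R) ^ n / fact (Suc n) * x ^ Suc n"
    by (rule deriv[OF main x])
qed

text \<open>
  The Weierstrass test makes the series of derivatives converge uniformly, which is what
  termwise differentiation asks for. Since one-sided derivatives are allowed, this applies at the
  endpoint of the half-line as well.
\<close>

lemma has_vector_derivative_suminf:
  fixes f :: "nat \<Rightarrow> real \<Rightarrow> 'a::banach"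
  assumes S: "convex S"
    and f: "\<And>n x. x \<in> S \<Longrightarrow> (f n has_vector_derivative f' n x) (at x within S)"
    and L: "\<And>n x. x \<in> S \<Longrightarrow> norm (f' n x) \<le> L n" "summable L"
    and sm: "\<And>x. x \<in> S \<Longrightarrow> summable (\<lambda>n. f n x)"
    and x: "x \<in> S"
  shows "((\<lambda>x. \<Sum>n. f n x) has_vector_derivative (\<Sum>n. f' n x)) (at x within S)"
proof -
  have "uniform_limit S (\<lambda>n x. \<Sum>i<n. f' i x) (\<lambda>x. \<Sum>i. f' i x) sequentially"
    using L by (intro Weierstrass_m_test) auto
  then have unif: "\<forall>\<^sub>F n in sequentially. \<forall>x\<in>S. norm ((\<Sum>i<n. f' i x) - (\<Sum>i. f' i x)) < e"
    if "e > 0" for e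
    using that by (auto simp: uniform_limit_iff dist_norm)
  have "\<exists>g. \<forall>x\<in>S. (\<lambda>n. f n x) sums (g x) \<and>
      (g has_derivative (\<lambda>h. h *\<^sub>R (\<Sum>n. f' n x))) (at x within S)"
  proof (rule has_derivative_series[where f = f and f' = "\<lambda>n x h. h *\<^sub>R f' n x"])
    show "(f n has_derivative (\<lambda>h. h *\<^sub>R f' n x)) (at x within S)" if "x \<in> S" for n x
      using f[OF that] by (simp add: has_vector_derivative_def)
  next
    fix e :: real assume "e > 0"
    from unif[OF this] show "\<forall>\<^sub>F n in sequentially. \<forall>x\<in>S. \<forall>h.
        norm ((\<Sum>i<n. h *\<^sub>R f' i x) - h *\<^sub>R (\<Sum>n. f' n x)) \<le> e * norm h"
    proof (rule eventually_mono, safe)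
      fix n x h assume n: "\<forall>x\<in>S. norm ((\<Sum>i<n. f' i x) - (\<Sum>i. f' i x)) < e" and "x \<in> S"
      have "norm ((\<Sum>i<n. h *\<^sub>R f' i x) - h *\<^sub>R (\<Sum>n. f' n x))
          = norm ((\<Sum>i<n. f' i x) - (\<Sum>i. f' i x)) * norm h"
        by (simp add: scaleR_sum_right[symmetric] scaleR_diff_right[symmetric])
      also have "\<dots> \<le> e * norm h"
        using n \<open>x \<in> S\<close> by (intro mult_right_mono) (auto intro: less_imp_le)
      finally show "norm ((\<Sum>i<n. h *\<^sub>R f' i x) - h *\<^sub>R (\<Sum>n. f' n x)) \<le> e * norm h" .
    qed
  qed (rule S x summable_sums[OF sm[OF x]])+
  then obtain g where g: "\<And>x. x \<in> S \<Longrightarrow> (\<lambda>n. f n x) sums (g x)"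
      "\<And>x. x \<in> S \<Longrightarrow> (g has_derivative (\<lambda>h. h *\<^sub>R (\<Sum>n. f' n x))) (at x within S)"
    by blast
  have "g y = (\<Sum>n. f n y)" if "y \<in> S" for y
    using g(1)[OF that] by (simp add: sums_iff)
  then show ?thesis
    unfolding has_vector_derivative_def
    by (intro has_derivative_transform[OF x _ g(2)[OF x]]) simp
qed

definition series_sol :: "(real \<Rightarrow> real) \<Rightarrow> real \<Rightarrow> real \<Rightarrow> complex \<Rightarrow> real \<Rightarrow> complex" where
  "series_sol q p d z x = (\<Sum>n. of_real (iter_coeff q p d n x) * z ^ n)"

definition series_sol_deriv :: "(real \<Rightarrow> real) \<Rightarrow> real \<Rightarrow> real \<Rightarrow> complex \<Rightarrow> real \<Rightarrow> complex" where
  "series_sol_deriv q p d z x = (\<Sum>n. of_real (iter_coeff_deriv q p d n x) * z ^ n)"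

text \<open>
  Up to constant factors and the shift of index in the differentiated series, both majorants are
  exponential series in \<open>M * R\<^sup>2 * norm z\<close>, where \<open>M\<close> bounds \<open>q\<close> on \<open>[0, R]\<close>. This
  one estimate yields convergence everywhere, the differential equation, and analyticity in
  \<open>z\<close>.
\<close>

lemma iter_coeff_series_dominated:
  fixes q :: "real \<Rightarrow> real" and z :: complex
  assumes q: "continuous_on {0..} q"
  obtains L L' where "summable L" "summable L'"
    "\<And>n x. x \<in> {0..R} \<Longrightarrow> norm (of_real (iter_coeff q p d n x) * z ^ n) \<le> L n"
    "\<And>n x. x \<in> {0..R} \<Longrightarrow> norm (of_real (iter_coeff_deriv q p d n x) * z ^ n) \<le> L' n"
proof -
  have "compact (q ` {0..R})"
    by (intro compact_continuous_image continuous_on_subset[OF q]) auto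
  then obtain M where M: "\<And>t. t \<in> {0..R} \<Longrightarrow> \<bar>q t\<bar> \<le> M"
    by (force dest!: compact_imp_bounded simp: bounded_iff)
  define C where "C = \<bar>p\<bar> + \<bar>d\<bar> * R"
  define r where "r = M * R * R * norm z"
  define L where "L = (\<lambda>n. C * (r ^ n / fact n))"
  define L' where "L' = (\<lambda>n. case n of 0 \<Rightarrow> \<bar>d\<bar> | Suc m \<Rightarrow> M * C * R * norm z * (r ^ m / fact m))"
  have exp: "summable (\<lambda>n. r ^ n / fact n)"
    using summable_exp_generic[of r] by (simp add: divide_inverse mult.commute)
  show thesis
  proof (rule that[of L L'])
    show "summable L"
      unfolding L_def by (intro summable_mult exp)
    have "summable (\<lambda>n. L' (Suc n))"
      unfolding L'_def nat.case by (intro summable_mult exp)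
    then show "summable L'"
      by (simp add: summable_Suc_iff)
  next
    fix n x assume x: "x \<in> {0..R}"
    have M0: "M \<ge> 0" and R: "R \<ge> 0" using M[OF x] x by auto
    have C: "C \<ge> 0" unfolding C_def using R by auto
    have "norm (of_real (iter_coeff q p d n x) * z ^ n)
        \<le> (C * (M * R) ^ n / fact n * x ^ n) * norm z ^ n"
      using abs_iter_coeff_le[OF q M x, of p d n, folded C_def]
      by (simp only: norm_mult norm_power norm_of_real mult_right_mono zero_le_power norm_ge_zero)
    also have "\<dots> \<le> (C * (M * R) ^ n / fact n * R ^ n) * norm z ^ n"
      using x M0 C R by (intro mult_right_mono mult_left_mono power_mono) auto
    also have "\<dots> = L n"
      by (simp add: L_def r_def power_mult_distrib)
    finally show "norm (of_real (iter_coeff q p d n x) * z ^ n) \<le> L n" .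
    show "norm (of_real (iter_coeff_deriv q p d n x) * z ^ n) \<le> L' n"
    proof (cases n)
      case 0
      then show ?thesis by (simp add: L'_def)
    next
      case (Suc m)
      have "norm (of_real (iter_coeff_deriv q p d n x) * z ^ n)
          \<le> (M * C * (M * R) ^ m / fact (Suc m) * x ^ Suc m) * norm z ^ Suc m"
        using abs_iter_coeff_deriv_le[OF q M x, of p d m, folded C_def]
        unfolding Suc by (simp only: norm_mult norm_power norm_of_real mult_right_mono
            zero_le_power norm_ge_zero)
      also have "\<dots> \<le> (M * C * (M * R) ^ m / fact m * R ^ Suc m) * norm z ^ Suc m"
        using x M0 C R
        by (intro mult_right_mono mult_mono power_mono divide_left_mono fact_mono) auto
      also have "\<dots> = L' n"
        by (simp add: L'_def r_def Suc power_mult_distrib)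
      finally show ?thesis .
    qed
  qed
qed

lemma summable_iter_coeff:
  fixes z :: complex
  assumes q: "continuous_on {0..} q" and x: "x \<ge> 0"
  shows "summable (\<lambda>n. of_real (iter_coeff q p d n x) * z ^ n)"
    and "summable (\<lambda>n. of_real (iter_coeff_deriv q p d n x) * z ^ n)"
proof -
  obtain L L' where L: "summable L" "summable L'"
    "\<And>n x'. x' \<in> {0..x} \<Longrightarrow> norm (of_real (iter_coeff q p d n x') * z ^ n) \<le> L n"
    "\<And>n x'. x' \<in> {0..x} \<Longrightarrow> norm (of_real (iter_coeff_deriv q p d n x') * z ^ n) \<le> L' n"
    using iter_coeff_series_dominated[OF q] by metis
  then show "summable (\<lambda>n. of_real (iter_coeff q p d n x) * z ^ n)"
      "summable (\<lambda>n. of_real (iter_coeff_deriv q p d n x) * z ^ n)"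
    using x by (auto intro: summable_comparison_test'[where N = 0])
qed

lemma series_sol_has_derivative:
  assumes q: "continuous_on {0..} q" and x: "x \<ge> 0"
  shows "(series_sol q p d z has_vector_derivative series_sol_deriv q p d z x) (at x within {0..})"
proof -
  obtain L L' where L: "summable L" "summable L'"
    "\<And>n y. y \<in> {0..x+1} \<Longrightarrow> norm (of_real (iter_coeff q p d n y) * z ^ n) \<le> L n"
    "\<And>n y. y \<in> {0..x+1} \<Longrightarrow> norm (of_real (iter_coeff_deriv q p d n y) * z ^ n) \<le> L' n"
    using iter_coeff_series_dominated[OF q] by metis
  have "((\<lambda>x. \<Sum>n. of_real (iter_coeff q p d n x) * z ^ n) has_vector_derivative
      (\<Sum>n. of_real (iter_coeff_deriv q p d n x) * z ^ n)) (at x within {0..x+1})"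
  proof (rule has_vector_derivative_suminf[OF _ _ L(4,2)])
    fix n y assume y: "y \<in> {0..x+1}"
    have "(iter_coeff q p d n has_real_derivative iter_coeff_deriv q p d n y) (at y within {0..x+1})"
      using y by (intro DERIV_subset[OF iter_coeff_has_derivative[OF q]]) simp_all
    then show "((\<lambda>y. of_real (iter_coeff q p d n y) * z ^ n) has_vector_derivative
        of_real (iter_coeff_deriv q p d n y) * z ^ n) (at y within {0..x+1})"
      by (intro has_vector_derivative_mult_left has_vector_derivative_of_real)
    show "summable (\<lambda>n. of_real (iter_coeff q p d n y) * z ^ n)"
      using summable_iter_coeff[OF q] y by auto
  qed (use x in auto)
  then show ?thesis
    by (subst at_within_atLeast_eq_Icc[of x "x+1"]) (auto simp: series_sol_def[abs_def] series_sol_deriv_def)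
qed

lemma series_sol_deriv_has_derivative:
  assumes q: "continuous_on {0..} q" and x: "x \<ge> 0"
  shows "(series_sol_deriv q p d z has_vector_derivative z * of_real (q x) * series_sol q p d z x)
           (at x within {0..})"
proof -
  obtain L L' where L: "summable L" "summable L'"
    "\<And>n y. y \<in> {0..x+1} \<Longrightarrow> norm (of_real (iter_coeff q p d n y) * z ^ n) \<le> L n"
    "\<And>n y. y \<in> {0..x+1} \<Longrightarrow> norm (of_real (iter_coeff_deriv q p d n y) * z ^ n) \<le> L' n"
    using iter_coeff_series_dominated[OF q] by metis
  have "compact (q ` {0..x+1})"
    by (intro compact_continuous_image continuous_on_subset[OF q]) auto
  then obtain M where M: "\<And>t. t \<in> {0..x+1} \<Longrightarrow> \<bar>q t\<bar> \<le> M"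
    by (force dest!: compact_imp_bounded simp: bounded_iff)
  \<comment> \<open>The zeroth term has zero derivative; the shift by one index produces the factor \<open>z\<close>.\<close>
  define h where "h = (\<lambda>n y. case n of 0 \<Rightarrow> 0 
    | Suc m \<Rightarrow> z * of_real (q y) * (of_real (iter_coeff q p d m y) * z ^ m))"
  define K where "K = (\<lambda>n. case n of 0 \<Rightarrow> 0 | Suc m \<Rightarrow> norm z * M * L m)"
  have "((\<lambda>x. \<Sum>n. of_real (iter_coeff_deriv q p d n x) * z ^ n) has_vector_derivative
      (\<Sum>n. h n x)) (at x within {0..x+1})"
  proof (rule has_vector_derivative_suminf)
    fix n y assume y: "y \<in> {0..x+1}"
    show "((\<lambda>y. of_real (iter_coeff_deriv q p d n y) * z ^ n) has_vector_derivative h n y)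
        (at y within {0..x+1})"
    proof (cases n)
      case 0
      then show ?thesis by (simp add: h_def)
    next
      case (Suc m)
      have "(iter_coeff_deriv q p d n has_real_derivative q y * iter_coeff q p d m y)
          (at y within {0..x+1})"
        unfolding Suc
        using y by (intro DERIV_subset[OF iter_coeff_deriv_Suc_has_derivative[OF q]])
          (simp_all del: iter_coeff_deriv.simps)
      then have "((\<lambda>y. of_real (iter_coeff_deriv q p d n y) * z ^ n) has_vector_derivative
          of_real (q y * iter_coeff q p d m y) * z ^ n) (at y within {0..x+1})"
        by (intro has_vector_derivative_mult_left has_vector_derivative_of_real)
      also have "of_real (q y * iter_coeff q p d m y) * z ^ n = h n y"
        by (simp add: h_def Suc)
      finally show ?thesis .
    qed
    show "norm (h n y) \<le> K n"
    proof (cases n)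
      case (Suc m)
      have "norm (h n y) = (norm z * \<bar>q y\<bar>) * norm (of_real (iter_coeff q p d m y) * z ^ m)"
        by (simp add: h_def Suc norm_mult)
      also have "\<dots> \<le> (norm z * M) * L m"
        using M[OF y] L(3)[OF y] by (intro mult_mono) (auto intro: order_trans[OF abs_ge_zero])
      finally show ?thesis by (simp add: K_def Suc)
    qed (simp add: h_def K_def)
    show "summable (\<lambda>n. of_real (iter_coeff_deriv q p d n y) * z ^ n)"
      using summable_iter_coeff[OF q] y by auto
  next
    have "summable (\<lambda>n. K (Suc n))"
      unfolding K_def nat.case by (intro summable_mult L)
    then show "summable K"
      by (simp add: summable_Suc_iff)
  qed (use x in auto)
  moreover have "(\<Sum>n. h n x) = z * of_real (q x) * series_sol q p d z x"
  proof -
    have "(\<lambda>n. h (Suc n) x) sums (z * of_real (q x) * series_sol q p d z x)"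
      unfolding h_def nat.case series_sol_def
      by (intro sums_mult summable_sums summable_iter_coeff[OF q x])
    then have "(\<lambda>n. h n x) sums (z * of_real (q x) * series_sol q p d z x + h 0 x)"
      by (rule sums_Suc)
    then show ?thesis
      by (simp add: h_def sums_iff)
  qed
  ultimately show ?thesis
    by (subst at_within_atLeast_eq_Icc[of x "x+1"]) (auto simp: series_sol_deriv_def[abs_def])
qed

lemma iter_coeff_at_0:
  "iter_coeff q p d n 0 = (if n = 0 then p else 0)"
  "iter_coeff_deriv q p d n 0 = (if n = 0 then d else 0)"
  by (cases n; simp)+

lemma series_sol_at_0: "series_sol q p d z 0 = of_real p"
  unfolding series_sol_def iter_coeff_at_0 by (subst suminf_finite[of "{0}"]) auto

lemma series_sol_deriv_at_0: "series_sol_deriv q p d z 0 = of_real d"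
  unfolding series_sol_deriv_def iter_coeff_at_0 by (subst suminf_finite[of "{0}"]) auto

text \<open>
  For fixed \<open>x\<close> the solution is a power series in \<open>z\<close> with infinite radius of convergence. This
  is what controls the limit \<open>k \<rightarrow> 0\<close> later on.
\<close>

lemma isCont_series_sol:
  assumes "continuous_on {0..} q" "x \<ge> 0"
  shows "isCont (\<lambda>z. series_sol q p d z x) z" "isCont (\<lambda>z. series_sol_deriv q p d z x) z"
  unfolding series_sol_def series_sol_deriv_def
  by (rule isCont_powser_converges_everywhere, rule summable_iter_coeff[OF assms])+

lemma series_sol_of_real:
  assumes "continuous_on {0..} q" "x \<ge> 0"
  shows "series_sol q p d (of_real t) x \<in> \<real>" "series_sol_deriv q p d (of_real t) x \<in> \<real>"
proof -
  have *: "(\<Sum>n. of_real (c n) * (of_real t :: complex) ^ n) \<in> \<real>"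
    if "summable (\<lambda>n. of_real (c n) * (of_real t :: complex) ^ n)" for c
  proof -
    have "(\<lambda>n. \<Sum>i<n. of_real (c i) * (of_real t :: complex) ^ i)
        \<longlonglongrightarrow> (\<Sum>n. of_real (c n) * of_real t ^ n)"
      using that by (rule summable_LIMSEQ)
    then show ?thesis
      by (rule closed_sequentially[OF closed_complex_Reals, rotated]) (auto intro!: Reals_mult Reals_power)
  qed
  show "series_sol q p d (of_real t) x \<in> \<real>" "series_sol_deriv q p d (of_real t) x \<in> \<real>"
    unfolding series_sol_def series_sol_deriv_def
    by (rule *, rule summable_iter_coeff[OF assms])+
qed

section \<open>Wronskians and uniqueness\<close>

text \<open>
  The endpoint is exempt from the derivative condition because solutions satisfy the equation
  only at \<open>x > 0\<close>; continuity carries the value across.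
\<close>

lemma constant_on_atLeast:
  fixes g :: "real \<Rightarrow> complex"
  assumes "continuous_on {a..} g" "\<And>x. x > a \<Longrightarrow> (g has_vector_derivative 0) (at x)" "x \<ge> a"
  shows "g x = g a"
proof (rule has_derivative_zero_unique_strong_convex[of "{a..}" "{a}" g a])
  fix y assume "y \<in> {a..} - {a}"
  then show "(g has_derivative (\<lambda>h. 0)) (at y within {a..})"
    using assms(2)[of y] by (auto simp: has_vector_derivative_def intro: has_derivative_at_withinI)
qed (use assms in auto)

lemma at_within_atLeast_eq_at:
  fixes x :: real
  assumes "x > a"
  shows "at x within {a..} = at x"
  using assms by (intro at_within_interior) auto

lemma trivial_limit_at_within_atLeast:
  fixes x :: real
  assumes "x \<ge> a"
  shows "at x within {a..} \<noteq> bot"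
proof -
  have "at x within {x<..} \<le> at x within {a..}"
    using assms by (intro at_le) auto
  then show ?thesis
    using trivial_limit_at_right_real[of x] by (metis bot.extremum_uniqueI)
qed

lemma deriv_hl_eqI:
  assumes "(u has_vector_derivative v) (at x within {0..})" "x \<ge> 0"
  shows "deriv_hl u x = v"
  unfolding deriv_hl_def
  using assms by (intro vector_derivative_within trivial_limit_at_within_atLeast)

text \<open>
  A candidate derivative \<open>v\<close> may be supplied in place of the definite \<open>deriv_hl u\<close>; only the
  values of either on \<open>[0, \<infinity>)\<close> matter.
\<close>

lemma is_solutionI:
  assumes u: "\<And>x. x \<ge> 0 \<Longrightarrow> (u has_vector_derivative v x) (at x within {0..})"
    and v: "continuous_on {0..} v"
    and v': "\<And>x. x > 0 \<Longrightarrow> (v has_vector_derivative - (k\<^sup>2 * of_real (\<rho> x) * u x)) (at x)"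
  shows "is_solution \<rho> k u" and "x \<ge> 0 \<Longrightarrow> deriv_hl u x = v x"
proof -
  show eq: "deriv_hl u x = v x" if "x \<ge> 0" for x
    using deriv_hl_eqI[OF u] that by auto
  show "is_solution \<rho> k u"
    unfolding is_solution_def
  proof (intro conjI allI impI)
    show "u differentiable (at x within {0..})" if "x \<ge> 0" for x
      using u[OF that] by (rule differentiableI_vector)
    show "continuous_on {0..} (deriv_hl u)"
      by (rule continuous_on_eq[OF v]) (simp add: eq)
    fix x :: real assume x: "x > 0"
    have "(deriv_hl u has_vector_derivative - (k\<^sup>2 * of_real (\<rho> x) * u x)) (at x)"
      by (rule has_vector_derivative_transform_within_open[OF v'[OF x], of "{0<..}"])
        (use x eq in auto)
    then show "\<exists>w. (deriv_hl u has_vector_derivative w) (at x) \<and> w + k\<^sup>2 * of_real (\<rho> x) * u x = 0"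
      by (intro exI conjI) auto
  qed
qed

lemma is_solutionD:
  assumes "is_solution \<rho> k u"
  shows is_solution_has_derivative:
      "x \<ge> 0 \<Longrightarrow> (u has_vector_derivative deriv_hl u x) (at x within {0..})"
    and is_solution_continuous: "continuous_on {0..} u"
    and is_solution_continuous_deriv: "continuous_on {0..} (deriv_hl u)"
    and is_solution_deriv_has_derivative:
      "x > 0 \<Longrightarrow> (deriv_hl u has_vector_derivative - (k\<^sup>2 * of_real (\<rho> x) * u x)) (at x)"
proof -
  show *: "(u has_vector_derivative deriv_hl u x) (at x within {0..})" if "x \<ge> 0" for x
    using assms that unfolding is_solution_def deriv_hl_def
    by (simp add: vector_derivative_works)
  then show "continuous_on {0..} u"
    by (intro continuous_on_vector_derivative) auto
  show "continuous_on {0..} (deriv_hl u)"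
    using assms by (simp add: is_solution_def)
  show "(deriv_hl u has_vector_derivative - (k\<^sup>2 * of_real (\<rho> x) * u x)) (at x)" if "x > 0"
    using assms that unfolding is_solution_def by (metis add_eq_0_iff2)
qed

lemma is_solution_has_derivative_at:
  assumes "is_solution \<rho> k u" "x > 0"
  shows "(u has_vector_derivative deriv_hl u x) (at x)"
  using is_solution_has_derivative[OF assms(1), of x] assms(2) by (simp add: at_within_atLeast_eq_at)

lemma is_solution_scale_add:
  assumes u: "is_solution \<rho> k u" and w: "is_solution \<rho> k w"
  shows "is_solution \<rho> k (\<lambda>x. \<alpha> * u x + \<beta> * w x)" (is "is_solution \<rho> k ?y")
    and "x \<ge> 0 \<Longrightarrow> deriv_hl (\<lambda>x. \<alpha> * u x + \<beta> * w x) x = \<alpha> * deriv_hl u x + \<beta> * deriv_hl w x"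
proof -
  let ?v = "\<lambda>x. \<alpha> * deriv_hl u x + \<beta> * deriv_hl w x"
  have d: "(?y has_vector_derivative ?v x) (at x within {0..})" if "x \<ge> 0" for x
    using that
    by (intro derivative_intros is_solution_has_derivative[OF u] is_solution_has_derivative[OF w])
  have c: "continuous_on {0..} ?v"
    by (intro continuous_intros is_solution_continuous_deriv[OF u] is_solution_continuous_deriv[OF w])
  have "(?v has_vector_derivative
      \<alpha> * - (k\<^sup>2 * of_real (\<rho> x) * u x) + \<beta> * - (k\<^sup>2 * of_real (\<rho> x) * w x)) (at x)"
    if "x > 0" for x
    using that by (intro derivative_intros is_solution_deriv_has_derivative[OF u]
        is_solution_deriv_has_derivative[OF w])
  then have e: "(?v has_vector_derivative - (k\<^sup>2 * of_real (\<rho> x) * ?y x)) (at x)" if "x > 0" for x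
    using that by (simp add: algebra_simps)
  show "is_solution \<rho> k ?y"
    using is_solutionI(1)[of ?y ?v] d c e by blast
  show "deriv_hl ?y x = ?v x" if "x \<ge> 0"
    using is_solutionI(2)[of ?y ?v] d c e that by blast
qed

lemma is_solution_cong:
  assumes u: "is_solution \<rho> k u" and eq: "\<And>x. x \<ge> 0 \<Longrightarrow> u x = w x"
  shows "is_solution \<rho> k w" and "x \<ge> 0 \<Longrightarrow> deriv_hl w x = deriv_hl u x"
proof -
  have d: "(w has_vector_derivative deriv_hl u x) (at x within {0..})" if "x \<ge> 0" for x
    by (rule has_vector_derivative_transform[OF _ _ is_solution_has_derivative[OF u]])
      (use that eq in auto)
  have e: "(deriv_hl u has_vector_derivative - (k\<^sup>2 * of_real (\<rho> x) * w x)) (at x)" if "x > 0" for x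
    using is_solution_deriv_has_derivative[OF u that] eq[of x] that by simp
  note c = is_solution_continuous_deriv[OF u]
  show "is_solution \<rho> k w"
    using is_solutionI(1)[of w "deriv_hl u"] d c e by blast
  show "deriv_hl w x = deriv_hl u x" if "x \<ge> 0"
    using is_solutionI(2)[of w "deriv_hl u"] d c e that by blast
qed

definition wronskian :: "(real \<Rightarrow> complex) \<Rightarrow> (real \<Rightarrow> complex) \<Rightarrow> real \<Rightarrow> complex" where
  "wronskian u w x = u x * deriv_hl w x - deriv_hl u x * w x"

text \<open>
  The equation has no first-order term, so the derivative of the Wronskian vanishes.
\<close>

lemma wronskian_constant:
  assumes u: "is_solution \<rho> k u" and w: "is_solution \<rho> k w" and x: "x \<ge> 0"
  shows "wronskian u w x = wronskian u w 0"
  using _ _ x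
proof (rule constant_on_atLeast)
  show "continuous_on {0..} (wronskian u w)"
    unfolding wronskian_def
    by (intro continuous_intros is_solution_continuous[OF u] is_solution_continuous[OF w]
        is_solution_continuous_deriv[OF u] is_solution_continuous_deriv[OF w])
  fix y :: real assume y: "y > 0"
  have "((\<lambda>x. u x * deriv_hl w x - deriv_hl u x * w x) has_vector_derivative
      (u y * - (k\<^sup>2 * of_real (\<rho> y) * w y) + deriv_hl u y * deriv_hl w y)
      - (deriv_hl u y * deriv_hl w y + - (k\<^sup>2 * of_real (\<rho> y) * u y) * w y)) (at y)"
    using y by (intro has_vector_derivative_diff has_vector_derivative_mult
        is_solution_has_derivative_at[OF u] is_solution_has_derivative_at[OF w]
        is_solution_deriv_has_derivative[OF u] is_solution_deriv_has_derivative[OF w])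
  then show "(wronskian u w has_vector_derivative 0) (at y)"
    by (simp add: wronskian_def[abs_def] algebra_simps)
qed

lemma admissible_continuous_on:
  assumes "\<rho> \<in> admissible b"
  shows "continuous_on {0..} \<rho>"
  using assms by (auto simp: admissible_def intro: DERIV_continuous_on)

lemma series_sol_is_solution:
  assumes "continuous_on {0..} \<rho>"
  shows "is_solution \<rho> k (series_sol \<rho> p d (- k\<^sup>2))"
    and "x \<ge> 0 \<Longrightarrow> deriv_hl (series_sol \<rho> p d (- k\<^sup>2)) x = series_sol_deriv \<rho> p d (- k\<^sup>2) x"
proof -
  let ?u = "series_sol \<rho> p d (- k\<^sup>2)" and ?v = "series_sol_deriv \<rho> p d (- k\<^sup>2)"
  note d = series_sol_has_derivative[OF assms, of _ p d "- k\<^sup>2"]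
  note d' = series_sol_deriv_has_derivative[OF assms, of _ p d "- k\<^sup>2"]
  have c: "continuous_on {0..} ?v"
    using d' by (intro continuous_on_vector_derivative) auto
  have e: "(?v has_vector_derivative - (k\<^sup>2 * of_real (\<rho> x) * ?u x)) (at x)" if "x > 0" for x
    using d'[of x] that by (simp add: at_within_atLeast_eq_at)
  show "is_solution \<rho> k ?u"
    using is_solutionI(1)[of ?u ?v] d c e by blast
  show "deriv_hl ?u x = ?v x" if "x \<ge> 0"
    using is_solutionI(2)[of ?u ?v] d c e that by blast
qed

lemma fundamental_system:
  assumes "continuous_on {0..} \<rho>"
  obtains c s where "is_solution \<rho> k c" "is_solution \<rho> k s" "\<And>x. x \<ge> 0 \<Longrightarrow> wronskian c s x = 1"
proof -
  define c where "c = series_sol \<rho> 1 0 (- k\<^sup>2)"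
  define s where "s = series_sol \<rho> 0 1 (- k\<^sup>2)"
  have cs: "is_solution \<rho> k c" "is_solution \<rho> k s"
    using series_sol_is_solution assms by (auto simp: c_def s_def)
  have "wronskian c s 0 = 1"
    using series_sol_is_solution(2)[OF assms]
    by (simp add: wronskian_def c_def s_def series_sol_at_0 series_sol_deriv_at_0)
  then have "wronskian c s x = 1" if "x \<ge> 0" for x
    using wronskian_constant[OF cs that] by simp
  then show thesis
    using that cs by blast
qed

text \<open>
  A solution is a combination of the fundamental system with coefficients that are Wronskians,
  hence constant and determined by the Cauchy data at any one point.
\<close>

lemma solution_unique:
  assumes \<rho>: "continuous_on {0..} \<rho>"
    and u: "is_solution \<rho> k u" and w: "is_solution \<rho> k w" and a: "a \<ge> 0"
    and eq: "u a = w a" "deriv_hl u a = deriv_hl w a" and x: "x \<ge> 0"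
  shows "u x = w x"
proof -
  obtain c s where cs: "is_solution \<rho> k c" "is_solution \<rho> k s"
      and W: "\<And>x. x \<ge> 0 \<Longrightarrow> wronskian c s x = 1"
    using fundamental_system[OF \<rho>] by metis
  \<comment> \<open>A pointwise identity, by Cramer's rule with determinant \<open>wronskian c s x = 1\<close>.\<close>
  have expand: "y x = wronskian y s x * c x - wronskian y c x * s x" for y
  proof -
    have "wronskian y s x * c x - wronskian y c x * s x = wronskian c s x * y x"
      by (simp add: wronskian_def algebra_simps)
    then show ?thesis using W[OF x] by simp
  qed
  have "wronskian u y x = wronskian w y x" if "is_solution \<rho> k y" for y
  proof -
    have "wronskian u y a = wronskian w y a"
      by (simp add: wronskian_def eq)
    then show ?thesis
      using wronskian_constant[OF u that] wronskian_constant[OF w that] a x by metis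
  qed
  then show ?thesis
    using cs expand[of u] expand[of w] by metis
qed

text \<open>
  On \<open>[b, \<infinity>)\<close> the operator factors as \<open>(d/dx + i k) (d/dx - i k)\<close>, so two first-order
  uniqueness arguments suffice.
\<close>

lemma free_solution_eq_exp:
  assumes u: "is_solution \<rho> k u" and b: "b \<ge> 0" and \<rho>: "\<And>x. x \<ge> b \<Longrightarrow> \<rho> x = 1"
    and ub: "u b = exp (\<i> * k * of_real b)" "deriv_hl u b = \<i> * k * exp (\<i> * k * of_real b)"
    and x: "x \<ge> b"
  shows "u x = exp (\<i> * k * of_real x)" "deriv_hl u x = \<i> * k * exp (\<i> * k * of_real x)"
proof -
  have e: "((\<lambda>x. exp (a * of_real x)) has_vector_derivative a * exp (a * of_real x)) (at x)"
    for a :: complex and x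
    by (auto intro!: derivative_eq_intros has_vector_derivative_real_field)
  have cont: "continuous_on {b..} u" "continuous_on {b..} (deriv_hl u)"
    using is_solutionD(2,3)[OF u] b by (auto elim!: continuous_on_subset)
  let ?y = "\<lambda>x. deriv_hl u x - \<i> * k * u x"
  have "?y x * exp (\<i> * k * of_real x) = ?y b * exp (\<i> * k * of_real b)" if "x \<ge> b" for x
    using _ _ that
  proof (rule constant_on_atLeast)
    show "continuous_on {b..} (\<lambda>x. ?y x * exp (\<i> * k * of_real x))"
      by (intro continuous_intros cont)
    fix t :: real assume t: "t > b"
    have "((\<lambda>x. ?y x * exp (\<i> * k * of_real x)) has_vector_derivative
        ?y t * (\<i> * k * exp (\<i> * k * of_real t)) +
        (- (k\<^sup>2 * of_real (\<rho> t) * u t) - \<i> * k * deriv_hl u t) * exp (\<i> * k * of_real t)) (at t)"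
      using t b by (intro has_vector_derivative_diff has_vector_derivative_mult
          has_vector_derivative_mult_right e
          is_solution_has_derivative_at[OF u] is_solution_deriv_has_derivative[OF u]) auto
    also have "?y t * (\<i> * k * exp (\<i> * k * of_real t)) +
        (- (k\<^sup>2 * of_real (\<rho> t) * u t) - \<i> * k * deriv_hl u t) * exp (\<i> * k * of_real t) = 0"
      using \<rho>[of t] t by (simp add: algebra_simps power2_eq_square)
    finally show "((\<lambda>x. ?y x * exp (\<i> * k * of_real x)) has_vector_derivative 0) (at t)" .
  qed
  then have du: "deriv_hl u x = \<i> * k * u x" if "x \<ge> b" for x
    using that ub by simp
  have "u x * exp (- (\<i> * k) * of_real x) = u b * exp (- (\<i> * k) * of_real b)"
    using _ _ x
  proof (rule constant_on_atLeast)
    show "continuous_on {b..} (\<lambda>x. u x * exp (- (\<i> * k) * of_real x))"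
      by (intro continuous_intros cont)
    fix t :: real assume t: "t > b"
    have "((\<lambda>x. u x * exp (- (\<i> * k) * of_real x)) has_vector_derivative
        u t * (- (\<i> * k) * exp (- (\<i> * k) * of_real t)) +
        (\<i> * k * u t) * exp (- (\<i> * k) * of_real t)) (at t)"
      using t b is_solution_has_derivative_at[OF u, of t] du[of t]
      by (intro has_vector_derivative_mult e) auto
    then show "((\<lambda>x. u x * exp (- (\<i> * k) * of_real x)) has_vector_derivative 0) (at t)"
      by simp
  qed
  also have "\<dots> = 1"
    by (simp add: ub mult_exp_exp)
  finally have "u x = exp (\<i> * k * of_real x)"
    by (simp add: exp_minus field_simps)
  then show "u x = exp (\<i> * k * of_real x)" "deriv_hl u x = \<i> * k * exp (\<i> * k * of_real x)"
    using du[OF x] by auto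
qed

section \<open>The regular and the Jost solution\<close>

lemma phi_eq_series_sol:
  assumes \<rho>: "continuous_on {0..} \<rho>"
  shows "\<phi> \<rho> k = (\<lambda>x. if x < 0 then 0 else series_sol \<rho> 0 1 (- k\<^sup>2) x)" (is "_ = ?u")
  unfolding \<phi>_def
proof (rule the_equality)
  note s = series_sol_is_solution[OF \<rho>, where k = k and p = 0 and d = 1]
  have u: "is_solution \<rho> k ?u" "deriv_hl ?u 0 = deriv_hl (series_sol \<rho> 0 1 (- k\<^sup>2)) 0"
    using is_solution_cong[OF s(1), of ?u] by auto
  then show P: "is_solution \<rho> k ?u \<and> ?u 0 = 0 \<and> deriv_hl ?u 0 = 1 \<and> (\<forall>x<0. ?u x = 0)"
    using s(2)[of 0] by (simp add: series_sol_at_0 series_sol_deriv_at_0)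
  fix u assume "is_solution \<rho> k u \<and> u 0 = 0 \<and> deriv_hl u 0 = 1 \<and> (\<forall>x<0. u x = 0)"
  then have u: "is_solution \<rho> k u" "u 0 = ?u 0" "deriv_hl u 0 = deriv_hl ?u 0" "\<forall>x<0. u x = ?u x"
    using P by simp_all
  have "u x = ?u x" for x
  proof (cases "x < 0")
    case True
    then show ?thesis using u(4) by blast
  next
    case False
    then show ?thesis
      using P by (intro solution_unique[OF \<rho> u(1) _ order_refl u(2,3)]) auto
  qed
  then show "u = ?u" by blast
qed

lemma phi_properties:
  assumes \<rho>: "continuous_on {0..} \<rho>"
  shows is_solution_phi: "is_solution \<rho> k (\<phi> \<rho> k)"
    and phi_at_0: "\<phi> \<rho> k 0 = 0"
    and phi_eq: "x \<ge> 0 \<Longrightarrow> \<phi> \<rho> k x = series_sol \<rho> 0 1 (- k\<^sup>2) x"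
    and deriv_hl_phi_eq: "x \<ge> 0 \<Longrightarrow> deriv_hl (\<phi> \<rho> k) x = series_sol_deriv \<rho> 0 1 (- k\<^sup>2) x"
    and deriv_hl_phi_at_0: "deriv_hl (\<phi> \<rho> k) 0 = 1"
proof -
  note s = series_sol_is_solution[OF \<rho>, where k = k and p = 0 and d = 1]
  show eq: "\<phi> \<rho> k x = series_sol \<rho> 0 1 (- k\<^sup>2) x" if "x \<ge> 0" for x
    using that by (simp add: phi_eq_series_sol[OF \<rho>])
  then show "is_solution \<rho> k (\<phi> \<rho> k)"
    using is_solution_cong(1)[OF s(1)] by simp
  show d: "deriv_hl (\<phi> \<rho> k) x = series_sol_deriv \<rho> 0 1 (- k\<^sup>2) x" if "x \<ge> 0" for x
    using is_solution_cong(2)[OF s(1), of "\<phi> \<rho> k" x] eq s(2)[OF that] that by simp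
  show "\<phi> \<rho> k 0 = 0" "deriv_hl (\<phi> \<rho> k) 0 = 1"
    using eq[of 0] d[of 0] by (auto simp: series_sol_at_0 series_sol_deriv_at_0)
qed

text \<open>
  Only \<open>k\<^sup>2\<close> enters the equation. Hence the values of \<open>jost\<close> at \<open>k\<close> and \<open>- k\<close> are
  expressed through the same \<open>\<phi>\<close>.
\<close>

lemma phi_uminus: "\<phi> \<rho> (- k) = \<phi> \<rho> k"
  by (simp add: \<phi>_def is_solution_def)

text \<open>
  The fundamental system supplies a solution with the Cauchy data of \<open>exp (\<i> * k * x)\<close> at
  \<open>b\<close>, and this solution is the exponential beyond \<open>b\<close>.
\<close>

lemma jost_properties:
  assumes b: "b \<ge> 0" and \<rho>: "continuous_on {0..} \<rho>" and free: "\<And>x. x \<ge> b \<Longrightarrow> \<rho> x = 1"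
  shows "is_solution \<rho> k (jost b \<rho> k) \<and>
     (\<forall>x\<ge>b. jost b \<rho> k x = exp (\<i> * k * of_real x) \<and>
            deriv_hl (jost b \<rho> k) x = \<i> * k * exp (\<i> * k * of_real x)) \<and>
     (\<forall>x<0. jost b \<rho> k x = 0)"
proof -
  obtain c s where cs: "is_solution \<rho> k c" "is_solution \<rho> k s"
      and W: "\<And>x. x \<ge> 0 \<Longrightarrow> wronskian c s x = 1"
    using fundamental_system[OF \<rho>] by metis
  define E where "E = exp (\<i> * k * of_real b)"
  \<comment> \<open>Cramer's rule for the Cauchy data at \<open>b\<close>; the determinant is the Wronskian, hence \<open>1\<close>.\<close>
  define \<alpha> where "\<alpha> = E * deriv_hl s b - \<i> * k * E * s b"
  define \<beta> where "\<beta> = \<i> * k * E * c b - E * deriv_hl c b"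
  define v where "v = (\<lambda>x. \<alpha> * c x + \<beta> * s x)"
  define u where "u = (\<lambda>x. if x < 0 then 0 else v x)"
  have v: "is_solution \<rho> k v" "deriv_hl v b = \<alpha> * deriv_hl c b + \<beta> * deriv_hl s b"
    unfolding v_def using is_solution_scale_add[OF cs] b by auto
  have u: "is_solution \<rho> k u" "deriv_hl u b = deriv_hl v b" "u b = v b"
    using is_solution_cong[OF v(1), of u] b by (auto simp: u_def)
  have "v b = wronskian c s b * E" "deriv_hl v b = wronskian c s b * (\<i> * k * E)"
    unfolding v(2) by (simp_all add: v_def \<alpha>_def \<beta>_def wronskian_def algebra_simps)
  then have "u b = E" "deriv_hl u b = \<i> * k * E"
    using u W[OF b] by auto
  then have ub: "u b = exp (\<i> * k * of_real b)" "deriv_hl u b = \<i> * k * exp (\<i> * k * of_real b)"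
    by (simp_all only: E_def)
  let ?P = "\<lambda>u. is_solution \<rho> k u \<and>
     (\<forall>x\<ge>b. u x = exp (\<i> * k * of_real x) \<and> deriv_hl u x = \<i> * k * exp (\<i> * k * of_real x)) \<and>
     (\<forall>x<0. u x = 0)"
  have P: "?P u"
    using free_solution_eq_exp[OF u(1) b free ub] u(1) unfolding u_def by meson
  have "\<exists>!u. ?P u"
  proof (rule ex1I[where P = ?P, OF P])
    fix w assume w: "?P w"
    have wb: "w b = u b" "deriv_hl w b = deriv_hl u b"
      using w ub by (metis order_refl)+
    have "w x = u x" for x
    proof (cases "x < 0")
      case True
      then show ?thesis using w P by metis
    next
      case False
      then show ?thesis
        using w by (intro solution_unique[OF \<rho> _ u(1) b wb]) auto
    qed
    then show "w = u" by blast
  qed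
  from theI'[OF this] show ?thesis
    unfolding jost_def .
qed

section \<open>Representing D by the Jost solution\<close>

text \<open>
  The Wronskian of the Jost solution and \<open>\<phi>\<close> equals \<open>f(0; k)\<close> at the origin, because of the
  initial values of \<open>\<phi>\<close>; at \<open>b\<close> it is computed from the explicit exponential.
\<close>

lemma jost_at_0:
  assumes b: "b \<ge> 0" and \<rho>: "continuous_on {0..} \<rho>" and free: "\<And>x. x \<ge> b \<Longrightarrow> \<rho> x = 1"
  shows "jost b \<rho> k 0 =
    exp (\<i> * k * of_real b) * (deriv_hl (\<phi> \<rho> k) b - \<i> * k * \<phi> \<rho> k b)"
proof -
  have f: "is_solution \<rho> k (jost b \<rho> k)" "jost b \<rho> k b = exp (\<i> * k * of_real b)"
      "deriv_hl (jost b \<rho> k) b = \<i> * k * exp (\<i> * k * of_real b)"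
    using jost_properties[OF assms] by blast+
  have "jost b \<rho> k 0 = wronskian (jost b \<rho> k) (\<phi> \<rho> k) 0"
    by (simp add: wronskian_def phi_at_0[OF \<rho>] deriv_hl_phi_at_0[OF \<rho>])
  also have "\<dots> = wronskian (jost b \<rho> k) (\<phi> \<rho> k) b"
    using wronskian_constant[OF f(1) is_solution_phi[OF \<rho>] b] by simp
  also have "\<dots> = exp (\<i> * k * of_real b) * (deriv_hl (\<phi> \<rho> k) b - \<i> * k * \<phi> \<rho> k b)"
    by (simp add: wronskian_def f algebra_simps)
  finally show ?thesis .
qed

lemma D_eq_jost_difference:
  assumes "b \<ge> 0" "continuous_on {0..} \<rho>" "\<And>x. x \<ge> b \<Longrightarrow> \<rho> x = 1" and k: "k \<noteq> 0"
  shows "D b \<rho> k = (jost b \<rho> k 0 - jost b \<rho> (- k) 0) / (2 * \<i> * k)"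
proof -
  define y y' where "y = \<phi> \<rho> k b" and "y' = deriv_hl (\<phi> \<rho> k) b"
  define s c where "s = sin (k * of_real b)" and "c = cos (k * of_real b)"
  have "exp (\<i> * k * of_real b) = c + \<i> * s" "exp (\<i> * (- k) * of_real b) = c - \<i> * s"
    using exp_Euler[of "k * of_real b"] exp_Euler[of "- (k * of_real b)"]
    by (simp_all add: s_def c_def mult.assoc)
  then have "jost b \<rho> k 0 - jost b \<rho> (- k) 0
      = (c + \<i> * s) * (y' - \<i> * k * y) - (c - \<i> * s) * (y' - \<i> * (- k) * y)"
    by (simp only: jost_at_0[OF assms(1-3)] phi_uminus y_def y'_def)
  also have "\<dots> = (2 * \<i> * k) * (s / k * y' - c * y)"
    using k by (simp add: algebra_simps)
  also have "s / k * y' - c * y = D b \<rho> k"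
    using k by (simp add: D_def y_def y'_def s_def c_def)
  finally show ?thesis
    using k by simp
qed

lemma isCont_phi:
  assumes "continuous_on {0..} \<rho>" "x \<ge> 0"
  shows "isCont (\<lambda>k. \<phi> \<rho> k x) k" "isCont (\<lambda>k. deriv_hl (\<phi> \<rho> k) x) k"
proof -
  have k: "isCont (\<lambda>k::complex. - k\<^sup>2) k"
    by (intro continuous_intros)
  show "isCont (\<lambda>k. \<phi> \<rho> k x) k"
    using isCont_o2[OF k isCont_series_sol(1)[OF assms]] by (simp only: phi_eq[OF assms])
  show "isCont (\<lambda>k. deriv_hl (\<phi> \<rho> k) x) k"
    using isCont_o2[OF k isCont_series_sol(2)[OF assms]] by (simp only: deriv_hl_phi_eq[OF assms])
qed

text \<open>
  The value chosen for \<open>sin (k * b) / k\<close> at \<open>k = 0\<close> is the derivative of \<open>sin (k * b)\<close> there.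
\<close>

lemma D_tendsto_at_0:
  assumes \<rho>: "continuous_on {0..} \<rho>" and b: "b \<ge> 0"
  shows "(D b \<rho> \<longlongrightarrow> D b \<rho> 0) (at 0)"
proof -
  have "((\<lambda>k. sin (k * of_real b)) has_field_derivative of_real b) (at (0 :: complex))"
    by (auto intro!: derivative_eq_intros)
  then have "((\<lambda>k::complex. sin (k * of_real b) / k) \<longlongrightarrow> of_real b) (at 0)"
    unfolding DERIV_def by simp
  moreover have "((\<lambda>k. \<phi> \<rho> k b) \<longlongrightarrow> \<phi> \<rho> 0 b) (at 0)"
      "((\<lambda>k. deriv_hl (\<phi> \<rho> k) b) \<longlongrightarrow> deriv_hl (\<phi> \<rho> 0) b) (at 0)"
    using isCont_phi[OF \<rho> b] unfolding isCont_def by blast+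
  moreover have "((\<lambda>k::complex. cos (k * of_real b)) \<longlongrightarrow> cos (0 * of_real b)) (at 0)"
    by (intro tendsto_intros)
  ultimately have "((\<lambda>k. sin (k * of_real b) / k * deriv_hl (\<phi> \<rho> k) b
      - cos (k * of_real b) * \<phi> \<rho> k b) \<longlongrightarrow> D b \<rho> 0) (at 0)"
    unfolding D_def if_P[OF refl] by (intro tendsto_intros)
  then show ?thesis
    by (rule Lim_transform_eventually) (auto simp: D_def eventually_at_filter)
qed

text \<open>
  For real \<open>k\<close> the series for \<open>\<phi>\<close> has real terms, so in \<open>jost_at_0\<close> only the exponential
  prefactor and the explicit \<open>\<i>\<close> contribute to the imaginary part.
\<close>

lemma Im_jost_at_0:
  assumes b: "b \<ge> 0" and \<rho>: "continuous_on {0..} \<rho>" and free: "\<And>x. x \<ge> b \<Longrightarrow> \<rho> x = 1"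
  shows "of_real (Im (jost b \<rho> (of_real k) 0)) = of_real k * D b \<rho> (of_real k)"
proof -
  have z: "- (of_real k)\<^sup>2 = (of_real (- k\<^sup>2) :: complex)"
    by simp
  obtain y y' where y: "\<phi> \<rho> (of_real k) b = of_real y" "deriv_hl (\<phi> \<rho> (of_real k)) b = of_real y'"
    using series_sol_of_real[OF \<rho> b, of 0 1 "- k\<^sup>2"]
    unfolding phi_eq[OF \<rho> b] deriv_hl_phi_eq[OF \<rho> b] z by (auto elim!: Reals_cases)
  have "exp (\<i> * of_real k * of_real b) = cis (k * b)"
    by (simp add: cis_conv_exp mult.assoc)
  then have "jost b \<rho> (of_real k) 0 = cis (k * b) * (of_real y' - \<i> * of_real k * of_real y)"
    by (simp only: jost_at_0[OF assms] y)
  then have "Im (jost b \<rho> (of_real k) 0) = sin (k * b) * y' - k * cos (k * b) * y"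
    by simp
  also have "of_real \<dots> = of_real k * D b \<rho> (of_real k)"
  proof (cases "k = 0")
    case False
    then show ?thesis
      unfolding D_def y of_real_mult[symmetric] sin_of_real cos_of_real
      by (simp add: right_diff_distrib)
  qed simp
  finally show ?thesis .
qed

theorem theorem2p3:
  fixes b :: real and \<rho> :: "real \<Rightarrow> real"
  assumes "b > 0" and "\<rho> \<in> admissible b"
  shows "(\<forall>k::complex. k \<noteq> 0 \<longrightarrow>
            D b \<rho> k = (jost b \<rho> k 0 - jost b \<rho> (- k) 0) / (2 * \<i> * k))
       \<and> ((\<lambda>k::complex. (jost b \<rho> k 0 - jost b \<rho> (- k) 0) / (2 * \<i> * k)) \<longlongrightarrow> D b \<rho> 0) (at 0)
       \<and> (\<forall>k::real. complex_of_real (Im (jost b \<rho> (of_real k) 0))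
                      = of_real k * D b \<rho> (of_real k))"
proof -
  have b: "b \<ge> 0" and \<rho>: "continuous_on {0..} \<rho>"
    using assms admissible_continuous_on by auto
  have free: "\<rho> x = 1" if "x \<ge> b" for x
    using assms(2) that unfolding admissible_def by blast
  have D: "D b \<rho> k = (jost b \<rho> k 0 - jost b \<rho> (- k) 0) / (2 * \<i> * k)" if "k \<noteq> 0" for k
    using D_eq_jost_difference[OF b \<rho> free that] .
  have "\<forall>\<^sub>F k in at 0. D b \<rho> k = (jost b \<rho> k 0 - jost b \<rho> (- k) 0) / (2 * \<i> * k)"
    unfolding eventually_at_filter by (rule always_eventually) (use D in blast)
  then have lim: "((\<lambda>k. (jost b \<rho> k 0 - jost b \<rho> (- k) 0) / (2 * \<i> * k)) \<longlongrightarrow> D b \<rho> 0) (at 0)"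
    by (rule Lim_transform_eventually[OF D_tendsto_at_0[OF \<rho> b]])
  have "complex_of_real (Im (jost b \<rho> (of_real k) 0)) = of_real k * D b \<rho> (of_real k)" for k
    using Im_jost_at_0[OF b \<rho> free] .
  with D lim show ?thesis
    by blast
qed

end
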